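(* Let $0\to\mathfrak{h}_S\xrightarrow{i}\mathfrak{e}_U\xrightarrow{p}\mathfrak{g}_T\to0$ be a non-abelian extension of Rota-Baxter Lie algebras and let $(\chi,\psi,\Phi)$ be the corresponding non-abelian $2$-cocycle induced by a section $s$ of $p$. A pair $(\beta,\alpha)\in\mathrm{Aut}(\mathfrak{h}_S)\times\mathrm{Aut}(\mathfrak{g}_T)$ is inducible if and only if there exists a linear map $\lambda\in\mathrm{Hom}(\mathfrak{g},\mathfrak{h})$ satisfying, for all $x,y\in\mathfrak{g}$ and $h\in\mathfrak{h}$: (I) $\beta(\psi_xh)-\psi_{\alpha(x)}\beta(h)=[\lambda(x),\beta(h)]_\mathfrak{h}$, (II) $\beta(\chi(x,y))-\chi(\alpha(x),\alpha(y))=\psi_{\alpha(x)}\lambda(y)-\psi_{\alpha(y)}\lambda(x)-\lambda([x,y]_\mathfrak{g})+[\lambda(x),\lambda(y)]_\mathfrak{h}$, (III) $\beta(\Phi(x))-\Phi(\alpha(x))=S(\lambda(x))-\lambda(T(x))$.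
   Context: All vector spaces, linear maps and Lie algebras are over a field $\mathbf{k}$ of characteristic $0$. A Rota-Baxter Lie algebra $\mathfrak{g}_T$ is a Lie algebra $\mathfrak{g}$ with a linear map $T:\mathfrak{g}\to\mathfrak{g}$ satisfying $[T(x),T(y)]_\mathfrak{g}=T([T(x),y]_\mathfrak{g}+[x,T(y)]_\mathfrak{g})$ for all $x,y\in\mathfrak{g}$. A morphism $\mathfrak{g}_T\to\mathfrak{g}'_{T'}$ is a Lie algebra homomorphism $\varphi$ with $T'\circ\varphi=\varphi\circ T$; $\mathrm{Aut}(\mathfrak{g}_T)$ is the group of bijective morphisms $\mathfrak{g}_T\to\mathfrak{g}_T$. A non-abelian extension of $\mathfrak{g}_T$ by $\mathfrak{h}_S$ is a Rota-Baxter Lie algebra $\mathfrak{e}_U$ with a short exact sequence $0\to\mathfrak{h}_S\xrightarrow{i}\mathfrak{e}_U\xrightarrow{p}\mathfrak{g}_T\to0$ of morphisms of Rota-Baxter Lie algebras; $\mathfrak{h}$ is identified with $i(\mathfrak{h})\subset\mathfrak{e}$. A section of $p$ is a linear map $s:\mathfrak{g}\to\mathfrak{e}$ with $p\circ s=\mathrm{id}_\mathfrak{g}$. The non-abelian $2$-cocycle induced by $s$ is the triple of linear maps $\chi:\wedge^2\mathfrak{g}\to\mathfrak{h}$, $\psi:\mathfrak{g}\to\mathrm{Der}(\mathfrak{h})$, $\Phi:\mathfrak{g}\to\mathfrak{h}$ given by $\chi(x,y)=[s(x),s(y)]_\mathfrak{e}-s[x,y]_\mathfrak{g}$, $\psi_x(h)=[s(x),h]_\mathfrak{e}$,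 $\Phi(x)=U(s(x))-s(T(x))$. A pair $(\beta,\alpha)\in\mathrm{Aut}(\mathfrak{h}_S)\times\mathrm{Aut}(\mathfrak{g}_T)$ is inducible if there is $\gamma\in\mathrm{Aut}(\mathfrak{e}_U)$ with $\gamma(\mathfrak{h})\subset\mathfrak{h}$, $\gamma|_\mathfrak{h}=\beta$ and $p\gamma s=\alpha$ (the map $p\gamma s$ does not depend on the section $s$). *)

theory Defs
  imports Complex_Main
begin

text \<open>The underlying set of every vector space is a whole type of class \<open>ab_group_add\<close>;
  the scalars form an arbitrary field of characteristic 0.\<close>

record ('k, 'v) rb_lie =
  scl :: "'k \<Rightarrow> 'v \<Rightarrow> 'v"
  brk :: "'v \<Rightarrow> 'v \<Rightarrow> 'v"
  rbop :: "'v \<Rightarrow> 'v"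

locale lie_algebra = vector_space scale
  for scale :: "'k::field_char_0 \<Rightarrow> 'v::ab_group_add \<Rightarrow> 'v" +
  fixes bracket :: "'v \<Rightarrow> 'v \<Rightarrow> 'v"
  assumes bracket_linear_right: "Vector_Spaces.linear scale scale (bracket x)"
    and bracket_linear_left: "Vector_Spaces.linear scale scale (\<lambda>x. bracket x y)"
    and bracket_alternating: "bracket x x = 0"
    and jacobi: "bracket x (bracket y z) + bracket y (bracket z x) + bracket z (bracket x y) = 0"

locale rota_baxter_lie_algebra = lie_algebra "scl L" "brk L"
  for L :: "('k::field_char_0, 'v::ab_group_add) rb_lie" +
  assumes rbop_linear: "Vector_Spaces.linear (scl L) (scl L) (rbop L)"
    and rota_baxter:
      "brk L (rbop L x) (rbop L y) = rbop L (brk L (rbop L x) y + brk L x (rbop L y))"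

definition rb_morphism ::
  "('k::field_char_0, 'v::ab_group_add) rb_lie \<Rightarrow> ('k, 'w::ab_group_add) rb_lie \<Rightarrow> ('v \<Rightarrow> 'w) \<Rightarrow> bool"
  where "rb_morphism L M f \<longleftrightarrow>
    Vector_Spaces.linear (scl L) (scl M) f \<and>
    (\<forall>x y. f (brk L x y) = brk M (f x) (f y)) \<and>
    rbop M \<circ> f = f \<circ> rbop L"

definition rb_Aut :: "('k::field_char_0, 'v::ab_group_add) rb_lie \<Rightarrow> ('v \<Rightarrow> 'v) set"
  where "rb_Aut L = {f. rb_morphism L L f \<and> bij f}"

locale rb_extension =
  H: rota_baxter_lie_algebra H + E: rota_baxter_lie_algebra E + G: rota_baxter_lie_algebra G
  for H :: "('k::field_char_0, 'h::ab_group_add) rb_lie"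
    and i :: "'h \<Rightarrow> 'e::ab_group_add"
    and E :: "('k, 'e::ab_group_add) rb_lie"
    and p :: "'e \<Rightarrow> 'g::ab_group_add"
    and G :: "('k, 'g::ab_group_add) rb_lie" +
  assumes i_morphism: "rb_morphism H E i"
    and p_morphism: "rb_morphism E G p"
    and i_inj: "inj i"
    and exact: "range i = {e. p e = 0}"
    and p_surj: "surj p"

definition is_section ::
  "('k::field_char_0, 'e::ab_group_add) rb_lie \<Rightarrow> ('e \<Rightarrow> 'g) \<Rightarrow> ('k, 'g::ab_group_add) rb_lie
    \<Rightarrow> ('g \<Rightarrow> 'e) \<Rightarrow> bool"
  where "is_section E p G s \<longleftrightarrow> Vector_Spaces.linear (scl G) (scl E) s \<and> p \<circ> s = id"

text \<open>The cocycle maps take values in the ideal \<open>range i\<close>, identified with \<open>'h\<close> via \<open>i\<close>;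
  \<open>inv i\<close> carries the values back to \<open>'h\<close>. That no value of \<open>inv i\<close> outside \<open>range i\<close> is
  involved is checked in \<open>i_chi\<close>, \<open>i_psi\<close> and \<open>i_Phi\<close> below.\<close>

definition cocycle_chi ::
  "('h \<Rightarrow> 'e) \<Rightarrow> ('k::field_char_0, 'e::ab_group_add) rb_lie \<Rightarrow> ('k, 'g::ab_group_add) rb_lie
    \<Rightarrow> ('g \<Rightarrow> 'e) \<Rightarrow> 'g \<Rightarrow> 'g \<Rightarrow> 'h"
  where "cocycle_chi i E G s x y = inv i (brk E (s x) (s y) - s (brk G x y))"

definition cocycle_psi ::
  "('h \<Rightarrow> 'e) \<Rightarrow> ('k::field_char_0, 'e::ab_group_add) rb_lie \<Rightarrow> ('g \<Rightarrow> 'e) \<Rightarrow> 'g \<Rightarrow> 'h \<Rightarrow> 'h"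
  where "cocycle_psi i E s x h = inv i (brk E (s x) (i h))"

definition cocycle_Phi ::
  "('h \<Rightarrow> 'e) \<Rightarrow> ('k::field_char_0, 'e::ab_group_add) rb_lie \<Rightarrow> ('k, 'g::ab_group_add) rb_lie
    \<Rightarrow> ('g \<Rightarrow> 'e) \<Rightarrow> 'g \<Rightarrow> 'h"
  where "cocycle_Phi i E G s x = inv i (rbop E (s x) - s (rbop G x))"

definition induced_cocycle ::
  "('h \<Rightarrow> 'e) \<Rightarrow> ('k::field_char_0, 'e::ab_group_add) rb_lie \<Rightarrow> ('k, 'g::ab_group_add) rb_lie
    \<Rightarrow> ('g \<Rightarrow> 'e) \<Rightarrow> ('g \<Rightarrow> 'g \<Rightarrow> 'h) \<times> ('g \<Rightarrow> 'h \<Rightarrow> 'h) \<times> ('g \<Rightarrow> 'h)"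
  where "induced_cocycle i E G s = (cocycle_chi i E G s, cocycle_psi i E s, cocycle_Phi i E G s)"

text \<open>With \<open>'h\<close> identified with \<open>range i\<close>, the restriction of \<open>\<gamma>\<close> to it is \<open>\<beta>\<close> iff
  \<open>\<gamma> \<circ> i = i \<circ> \<beta>\<close>. The choice of section \<open>s\<close> does not matter, see \<open>section_independent\<close> below.\<close>

definition inducible ::
  "('h \<Rightarrow> 'e) \<Rightarrow> ('k::field_char_0, 'e::ab_group_add) rb_lie \<Rightarrow> ('e \<Rightarrow> 'g) \<Rightarrow> ('g \<Rightarrow> 'e)
    \<Rightarrow> ('h \<Rightarrow> 'h) \<Rightarrow> ('g \<Rightarrow> 'g) \<Rightarrow> bool"
  where "inducible i E p s \<beta> \<alpha> \<longleftrightarrow>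
    (\<exists>\<gamma>\<in>rb_Aut E. \<gamma> ` range i \<subseteq> range i \<and> \<gamma> \<circ> i = i \<circ> \<beta> \<and> p \<circ> \<gamma> \<circ> s = \<alpha>)"

context rb_extension
begin

lemma p_linear: "Vector_Spaces.linear (scl E) (scl G) p"
  using p_morphism by (simp add: rb_morphism_def)

lemma p_diff: "p (a - b) = p a - p b"
proof -
  interpret p: Vector_Spaces.linear "scl E" "scl G" p by (rule p_linear)
  show ?thesis by (rule p.diff)
qed

lemma i_inv: "p e = 0 \<Longrightarrow> i (inv i e) = e"
  using exact by (intro f_inv_into_f) auto

lemma p_i: "p (i h) = 0"
  using exact by blast

lemma G_brk_0: "brk G x 0 = 0"
proof -
  interpret b: Vector_Spaces.linear "scl G" "scl G" "brk G x" by (rule G.bracket_linear_right)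
  show ?thesis by (rule b.zero)
qed

lemma i_chi:
  assumes "is_section E p G s"
  shows "i (cocycle_chi i E G s x y) = brk E (s x) (s y) - s (brk G x y)"
  using assms p_morphism
  by (simp add: cocycle_chi_def is_section_def rb_morphism_def i_inv p_diff pointfree_idE)

lemma i_psi: "i (cocycle_psi i E s x h) = brk E (s x) (i h)"
  using p_morphism by (simp add: cocycle_psi_def rb_morphism_def i_inv p_i G_brk_0)

lemma i_Phi:
  assumes "is_section E p G s"
  shows "i (cocycle_Phi i E G s x) = rbop E (s x) - s (rbop G x)"
proof -
  have "p (rbop E (s x)) = rbop G (p (s x))"
    using p_morphism unfolding rb_morphism_def by (metis comp_apply)
  then show ?thesis
    using assms by (simp add: cocycle_Phi_def is_section_def i_inv p_diff pointfree_idE)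
qed

lemma section_independent:
  assumes "is_section E p G s" "is_section E p G s'"
    and "\<gamma> \<in> rb_Aut E" "\<gamma> ` range i \<subseteq> range i"
  shows "p \<circ> \<gamma> \<circ> s = p \<circ> \<gamma> \<circ> s'"
proof
  fix x
  interpret c: Vector_Spaces.linear "scl E" "scl E" \<gamma>
    using assms(3) by (simp add: rb_Aut_def rb_morphism_def)
  have "p (s x - s' x) = 0"
    using assms(1,2) by (simp add: p_diff is_section_def pointfree_idE)
  then have "\<gamma> (s x - s' x) \<in> range i"
    using exact assms(4) by blast
  then have "p (\<gamma> (s x - s' x)) = 0"
    using exact by blast
  then show "(p \<circ> \<gamma> \<circ> s) x = (p \<circ> \<gamma> \<circ> s') x"
    by (simp add: c.diff p_diff)
qed

end

end

theory Submission
  imports Defs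
begin

text \<open>
  A section \<open>s\<close> splits \<open>\<ee>\<close> as a vector space: every element is uniquely \<open>i h + s x\<close>. Suppose
  \<open>\<gamma>\<close> is a linear map of \<open>\<ee>\<close> that restricts to \<open>\<beta>\<close> on \<open>\<hh>\<close> and induces \<open>\<alpha>\<close> on \<open>\<gg>\<close>. Then
  \<open>\<gamma> (s x) - s (\<alpha> x)\<close> is killed by \<open>p\<close>, so it equals \<open>i (l x)\<close> for a linear \<open>l\<close>; in block form, \<open>\<gamma>\<close>
  is triangular with diagonal blocks \<open>\<beta>\<close> and \<open>\<alpha>\<close> and off-diagonal block \<open>l\<close>. Conversely, every
  linear \<open>l\<close> gives such a \<open>\<gamma>\<close>, and \<open>\<gamma>\<close> is bijective because its diagonal blocks are.

  What remains is when such a \<open>\<gamma>\<close> is a morphism. Preservation of the bracket is a bilinear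
  and antisymmetric condition, so it need only be tested on pairs from \<open>i \<hh>\<close> and \<open>s \<gg>\<close>. On two
  elements of \<open>\<hh>\<close> it holds because \<open>\<beta>\<close> is a morphism; on a mixed pair it is condition (I), and
  on two values of \<open>s\<close> it is condition (II), when the bracket is expressed through the cocycle.
  Likewise commutation with the Rota-Baxter operator is automatic on \<open>\<hh>\<close> and is condition (III)
  on \<open>s \<gg>\<close>. Thus (I)-(III) hold exactly when \<open>\<gamma>\<close> is a morphism (\<open>lift_morphism_iff\<close>), and both
  directions of the theorem follow by passing between \<open>\<gamma>\<close> and \<open>l\<close>
  (\<open>lift_of_automorphism\<close>, \<open>lift_exists\<close>).
\<close>

section \<open>Additivity and antisymmetry of the bracket\<close>

context lie_algebra
begin

lemma bracket_add_right: "bracket x (y + z) = bracket x y + bracket x z"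
proof -
  interpret b: Vector_Spaces.linear scale scale "bracket x" by (rule bracket_linear_right)
  show ?thesis by (rule b.add)
qed

lemma bracket_add_left: "bracket (x + y) z = bracket x z + bracket y z"
proof -
  interpret b: Vector_Spaces.linear scale scale "\<lambda>x. bracket x z" by (rule bracket_linear_left)
  show ?thesis by (rule b.add)
qed

lemma bracket_antisym: "bracket y x = - bracket x y"
proof -
  have "bracket (x + y) (x + y) = bracket x y + bracket y x"
    by (simp only: bracket_add_left bracket_add_right) (simp add: bracket_alternating)
  then have "bracket x y + bracket y x = 0" by (simp add: bracket_alternating)
  then show ?thesis by (simp add: eq_neg_iff_add_eq_0 add.commute)
qed

end

section \<open>Splitting an extension along a section\<close>

context rb_extension
begin

lemma i_linear: "Vector_Spaces.linear (scl H) (scl E) i"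
  using i_morphism by (simp add: rb_morphism_def)

sublocale i: Vector_Spaces.linear "scl H" "scl E" i by (rule i_linear)
sublocale p: Vector_Spaces.linear "scl E" "scl G" p by (rule p_linear)
sublocale U: Vector_Spaces.linear "scl E" "scl E" "rbop E" by (rule E.rbop_linear)

lemma i_brk: "i (brk H h k) = brk E (i h) (i k)"
  using i_morphism by (simp add: rb_morphism_def)

lemma i_rbop: "i (rbop H h) = rbop E (i h)"
  using i_morphism by (simp add: rb_morphism_def fun_eq_iff)

lemma section_decomposition:
  assumes "is_section E p G s"
  obtains h x where "e = i h + s x"
proof -
  have "p (e - s (p e)) = 0"
    using assms by (simp add: p_diff is_section_def pointfree_idE)
  then have "e = i (inv i (e - s (p e))) + s (p e)" by (simp add: i_inv)
  then show thesis by (rule that)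
qed

end

section \<open>Triangular lifts of a pair of automorphisms\<close>

text \<open>
  The maps \<open>\<gamma>\<close> that are block triangular for the splitting \<open>\<ee> = i \<hh> + s \<gg>\<close>, with diagonal
  blocks \<open>\<beta>\<close>, \<open>\<alpha>\<close> and off-diagonal block \<open>l\<close>. Compatibility with brackets and Rota-Baxter
  operators is deliberately left open here, since (I)-(III) are to measure it.
\<close>

locale triangular_lift = rb_extension H i E p G
  for H :: "('k::field_char_0, 'h::ab_group_add) rb_lie"
    and i :: "'h \<Rightarrow> 'e::ab_group_add"
    and E :: "('k, 'e::ab_group_add) rb_lie"
    and p :: "'e \<Rightarrow> 'g::ab_group_add"
    and G :: "('k, 'g::ab_group_add) rb_lie" +
  fixes s :: "'g \<Rightarrow> 'e" and \<beta> :: "'h \<Rightarrow> 'h" and \<alpha> :: "'g \<Rightarrow> 'g"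
    and l :: "'g \<Rightarrow> 'h" and \<gamma> :: "'e \<Rightarrow> 'e"
  assumes is_section: "is_section E p G s"
    and \<beta>_Aut: "\<beta> \<in> rb_Aut H"
    and \<alpha>_Aut: "\<alpha> \<in> rb_Aut G"
    and \<gamma>_linear: "Vector_Spaces.linear (scl E) (scl E) \<gamma>"
    and \<gamma>_i: "\<gamma> (i h) = i (\<beta> h)"
    and \<gamma>_s: "\<gamma> (s x) = s (\<alpha> x) + i (l x)"
begin

sublocale \<gamma>: Vector_Spaces.linear "scl E" "scl E" \<gamma> by (rule \<gamma>_linear)

sublocale s: Vector_Spaces.linear "scl G" "scl E" s
  using is_section by (simp add: is_section_def)

sublocale \<beta>: Vector_Spaces.linear "scl H" "scl H" \<beta>
  using \<beta>_Aut by (simp add: rb_Aut_def rb_morphism_def)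

lemma p_s: "p (s x) = x"
  using is_section by (simp add: is_section_def pointfree_idE)

lemma \<beta>_brk: "\<beta> (brk H h k) = brk H (\<beta> h) (\<beta> k)"
  using \<beta>_Aut by (simp add: rb_Aut_def rb_morphism_def)

lemma \<beta>_rbop: "\<beta> (rbop H h) = rbop H (\<beta> h)"
  using \<beta>_Aut by (simp add: rb_Aut_def rb_morphism_def fun_eq_iff)

lemma \<alpha>_brk: "\<alpha> (brk G x y) = brk G (\<alpha> x) (\<alpha> y)"
  using \<alpha>_Aut by (simp add: rb_Aut_def rb_morphism_def)

lemma \<alpha>_rbop: "\<alpha> (rbop G x) = rbop G (\<alpha> x)"
  using \<alpha>_Aut by (simp add: rb_Aut_def rb_morphism_def fun_eq_iff)

lemma bij_lift: "bij \<gamma>"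
proof (rule bijI)
  have \<beta>: "bij \<beta>" and \<alpha>: "bij \<alpha>" using \<beta>_Aut \<alpha>_Aut by (simp_all add: rb_Aut_def)
  interpret \<alpha>: Vector_Spaces.linear "scl G" "scl G" \<alpha>
    using \<alpha>_Aut by (simp add: rb_Aut_def rb_morphism_def)
  show "inj \<gamma>"
    unfolding \<gamma>.inj_iff_eq_0
  proof (intro allI impI)
    fix e assume 0: "\<gamma> e = 0"
    obtain h x where e: "e = i h + s x" using section_decomposition[OF is_section] .
    have *: "i (\<beta> h) + (s (\<alpha> x) + i (l x)) = 0"
      using 0 by (simp add: e \<gamma>.add \<gamma>_i \<gamma>_s)
    \<comment> \<open>Applying \<open>p\<close> isolates the diagonal block \<open>\<alpha>\<close>; once \<open>x = 0\<close>, only \<open>\<beta>\<close> is left.\<close>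
    then have "p (i (\<beta> h) + (s (\<alpha> x) + i (l x))) = p 0" by (rule arg_cong)
    then have "\<alpha> x = 0" by (simp add: p.add p.zero p_i p_s)
    then have x: "x = 0" using bij_is_inj[OF \<alpha>] \<alpha>.inj_iff_eq_0 by blast
    \<comment> \<open>Linearity of \<open>\<gamma>\<close>, \<open>s\<close> and \<open>\<alpha>\<close> forces \<open>l\<close> to vanish at \<open>0\<close>.\<close>
    have "i (l 0) = 0" using \<gamma>_s[of 0] by (simp add: \<alpha>.zero s.zero \<gamma>.zero)
    then have "i (\<beta> h) = 0" using * by (simp add: x \<alpha>.zero s.zero)
    then have "\<beta> h = 0" using i_inj i.inj_iff_eq_0 by blast
    then have "h = 0" using bij_is_inj[OF \<beta>] \<beta>.inj_iff_eq_0 by blast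
    then show "e = 0" by (simp add: e x i.zero s.zero)
  qed
  show "surj \<gamma>"
    unfolding surj_def
  proof
    fix e
    obtain h x where e: "e = i h + s x" using section_decomposition[OF is_section] .
    obtain x' where x': "x = \<alpha> x'" using bij_is_surj[OF \<alpha>] by (rule surjE)
    obtain h' where h': "h - l x' = \<beta> h'" using bij_is_surj[OF \<beta>] by (rule surjE)
    have "\<gamma> (i h' + s x') = e"
      by (simp add: e x' \<gamma>.add \<gamma>_i \<gamma>_s h'[symmetric] i.diff)
    then show "\<exists>e'. e = \<gamma> e'" by blast
  qed
qed

text \<open>
  In the next three lemmas both sides are pulled back along the injective \<open>i\<close>, which turns
  the cocycle back into brackets and operators of \<open>\<ee>\<close>; the conditions on \<open>l\<close> then are
  the expansion of \<open>\<gamma> (s x) = s (\<alpha> x) + i (l x)\<close>.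
\<close>

lemma mixed_bracket_iff:
  "\<gamma> (brk E (s x) (i h)) = brk E (\<gamma> (s x)) (\<gamma> (i h)) \<longleftrightarrow>
    \<beta> (cocycle_psi i E s x h) - cocycle_psi i E s (\<alpha> x) (\<beta> h) = brk H (l x) (\<beta> h)"
proof -
  have "\<gamma> (brk E (s x) (i h)) = i (\<beta> (cocycle_psi i E s x h))"
    by (simp add: i_psi[symmetric] \<gamma>_i)
  moreover have "brk E (\<gamma> (s x)) (\<gamma> (i h)) =
      i (cocycle_psi i E s (\<alpha> x) (\<beta> h) + brk H (l x) (\<beta> h))"
    by (simp add: \<gamma>_i \<gamma>_s E.bracket_add_left i.add i_psi i_brk)
  ultimately show ?thesis
    by (simp add: inj_eq[OF i_inj] diff_eq_eq add.commute)
qed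

lemma section_bracket_iff:
  "\<gamma> (brk E (s x) (s y)) = brk E (\<gamma> (s x)) (\<gamma> (s y)) \<longleftrightarrow>
    \<beta> (cocycle_chi i E G s x y) - cocycle_chi i E G s (\<alpha> x) (\<alpha> y) =
      cocycle_psi i E s (\<alpha> x) (l y) - cocycle_psi i E s (\<alpha> y) (l x)
        - l (brk G x y) + brk H (l x) (l y)"
  (is "_ \<longleftrightarrow> \<beta> ?c - ?c' = ?r")
proof -
  have "brk E (s x) (s y) = i ?c + s (brk G x y)"
    by (simp add: i_chi[OF is_section])
  then have 1: "\<gamma> (brk E (s x) (s y)) = i (\<beta> ?c) + s (\<alpha> (brk G x y)) + i (l (brk G x y))"
    by (simp add: \<gamma>.add \<gamma>_i \<gamma>_s)
  have 2: "brk E (i (l x)) (s (\<alpha> y)) = - brk E (s (\<alpha> y)) (i (l x))"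
    by (rule E.bracket_antisym)
  have "brk E (\<gamma> (s x)) (\<gamma> (s y)) =
      i ?c' + i ?r + s (\<alpha> (brk G x y)) + i (l (brk G x y))"
    by (simp add: \<gamma>_s E.bracket_add_left E.bracket_add_right i.add i.diff i_psi i_brk 2
        i_chi[OF is_section] \<alpha>_brk algebra_simps)
  with 1 show ?thesis
    by (simp add: i.add[symmetric] inj_eq[OF i_inj] diff_eq_eq add.commute)
qed

lemma section_rbop_iff:
  "\<gamma> (rbop E (s x)) = rbop E (\<gamma> (s x)) \<longleftrightarrow>
    \<beta> (cocycle_Phi i E G s x) - cocycle_Phi i E G s (\<alpha> x) = rbop H (l x) - l (rbop G x)"
  (is "_ \<longleftrightarrow> \<beta> ?c - ?c' = ?r")
proof -
  have "rbop E (s x) = i ?c + s (rbop G x)"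
    by (simp add: i_Phi[OF is_section])
  then have 1: "\<gamma> (rbop E (s x)) = i (\<beta> ?c) + s (\<alpha> (rbop G x)) + i (l (rbop G x))"
    by (simp add: \<gamma>.add \<gamma>_i \<gamma>_s)
  have "rbop E (\<gamma> (s x)) = i ?c' + i ?r + s (\<alpha> (rbop G x)) + i (l (rbop G x))"
    by (simp add: \<gamma>_s U.add i.diff i_rbop i_Phi[OF is_section] \<alpha>_rbop algebra_simps)
  with 1 show ?thesis
    by (simp add: i.add[symmetric] inj_eq[OF i_inj] diff_eq_eq add.commute)
qed

text \<open>
  Since \<open>\<gamma>\<close> is linear, bracket preservation is additive in each argument, so it need only be tested on
  the two summands of \<open>i \<hh> + s \<gg>\<close>. The pairs absent on the right come for free: two elements of
  \<open>i \<hh>\<close> because \<open>\<beta>\<close> is a morphism, and the reversed mixed pairs by antisymmetry.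
\<close>

lemma lift_preserves_bracket_iff:
  "(\<forall>a b. \<gamma> (brk E a b) = brk E (\<gamma> a) (\<gamma> b)) \<longleftrightarrow>
    (\<forall>x h. \<gamma> (brk E (s x) (i h)) = brk E (\<gamma> (s x)) (\<gamma> (i h))) \<and>
    (\<forall>x y. \<gamma> (brk E (s x) (s y)) = brk E (\<gamma> (s x)) (\<gamma> (s y)))"
  (is "_ \<longleftrightarrow> ?mixed \<and> ?sect")
proof (intro iffI)
  assume hyp: "?mixed \<and> ?sect"
  have ii: "\<gamma> (brk E (i h) (i k)) = brk E (\<gamma> (i h)) (\<gamma> (i k))" for h k
    by (simp add: i_brk[symmetric] \<gamma>_i \<beta>_brk)
  have si: "\<gamma> (brk E (s x) (i h)) = brk E (\<gamma> (s x)) (\<gamma> (i h))" for x h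
    using hyp by blast
  have ss: "\<gamma> (brk E (s x) (s y)) = brk E (\<gamma> (s x)) (\<gamma> (s y))" for x y
    using hyp by blast
  have "is": "\<gamma> (brk E (i h) (s x)) = brk E (\<gamma> (i h)) (\<gamma> (s x))" for x h
    using si[of x h] E.bracket_antisym[of "i h" "s x"] E.bracket_antisym[of "\<gamma> (i h)" "\<gamma> (s x)"]
    by (simp add: \<gamma>.neg)
  show "\<forall>a b. \<gamma> (brk E a b) = brk E (\<gamma> a) (\<gamma> b)"
  proof (intro allI)
    fix a b
    obtain h x where a: "a = i h + s x" using section_decomposition[OF is_section] .
    obtain k y where b: "b = i k + s y" using section_decomposition[OF is_section] .
    show "\<gamma> (brk E a b) = brk E (\<gamma> a) (\<gamma> b)"
      by (simp only: a b E.bracket_add_left E.bracket_add_right \<gamma>.add ii si "is" ss)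
  qed
qed blast

lemma lift_commutes_rbop_iff:
  "rbop E \<circ> \<gamma> = \<gamma> \<circ> rbop E \<longleftrightarrow> (\<forall>x. \<gamma> (rbop E (s x)) = rbop E (\<gamma> (s x)))"
proof
  assume hyp: "\<forall>x. \<gamma> (rbop E (s x)) = rbop E (\<gamma> (s x))"
  have U_i: "\<gamma> (rbop E (i h)) = rbop E (\<gamma> (i h))" for h
    by (simp add: i_rbop[symmetric] \<gamma>_i \<beta>_rbop)
  show "rbop E \<circ> \<gamma> = \<gamma> \<circ> rbop E"
  proof
    fix e
    obtain h x where e: "e = i h + s x" using section_decomposition[OF is_section] .
    show "(rbop E \<circ> \<gamma>) e = (\<gamma> \<circ> rbop E) e"
      by (simp only: comp_apply e U.add \<gamma>.add U_i hyp)
  qed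
qed (simp add: fun_eq_iff)

lemma lift_morphism_iff:
  "rb_morphism E E \<gamma> \<longleftrightarrow>
    (\<forall>x h. \<beta> (cocycle_psi i E s x h) - cocycle_psi i E s (\<alpha> x) (\<beta> h) = brk H (l x) (\<beta> h)) \<and>
    (\<forall>x y. \<beta> (cocycle_chi i E G s x y) - cocycle_chi i E G s (\<alpha> x) (\<alpha> y) =
      cocycle_psi i E s (\<alpha> x) (l y) - cocycle_psi i E s (\<alpha> y) (l x)
        - l (brk G x y) + brk H (l x) (l y)) \<and>
    (\<forall>x. \<beta> (cocycle_Phi i E G s x) - cocycle_Phi i E G s (\<alpha> x) = rbop H (l x) - l (rbop G x))"
  unfolding rb_morphism_def lift_preserves_bracket_iff lift_commutes_rbop_iff
    mixed_bracket_iff section_bracket_iff section_rbop_iff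
  using \<gamma>_linear by blast

lemma lift_induces_quotient_map: "p \<circ> \<gamma> \<circ> s = \<alpha>"
  by (rule ext) (simp add: \<gamma>_s p.add p_s p_i)

lemma lift_image_kernel: "\<gamma> ` range i \<subseteq> range i"
  by (auto simp: \<gamma>_i)

end

section \<open>Lifts correspond to linear maps from the quotient to the kernel\<close>

context rb_extension
begin

text \<open>The block \<open>l\<close> is the defect \<open>\<gamma> s - s \<alpha>\<close>, which takes values in the kernel of \<open>p\<close>.\<close>

lemma lift_of_automorphism:
  assumes s: "is_section E p G s" and "\<beta> \<in> rb_Aut H" and \<alpha>: "\<alpha> \<in> rb_Aut G"
    and \<gamma>: "\<gamma> \<in> rb_Aut E" "\<gamma> \<circ> i = i \<circ> \<beta>" "p \<circ> \<gamma> \<circ> s = \<alpha>"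
  obtains l where "Vector_Spaces.linear (scl G) (scl H) l"
    and "triangular_lift H i E p G s \<beta> \<alpha> l \<gamma>"
proof -
  define l where "l x = inv i (\<gamma> (s x) - s (\<alpha> x))" for x
  interpret s: Vector_Spaces.linear "scl G" "scl E" s using s by (simp add: is_section_def)
  interpret \<gamma>: Vector_Spaces.linear "scl E" "scl E" \<gamma>
    using \<gamma>(1) by (simp add: rb_Aut_def rb_morphism_def)
  interpret \<alpha>: Vector_Spaces.linear "scl G" "scl G" \<alpha>
    using \<alpha> by (simp add: rb_Aut_def rb_morphism_def)
  have "p (s x) = x" "p (\<gamma> (s x)) = \<alpha> x" for x
    using s \<gamma>(3) by (auto simp: is_section_def pointfree_idE)
  then have i_l: "i (l x) = \<gamma> (s x) - s (\<alpha> x)" for x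
    by (simp add: l_def i_inv p_diff)
  show thesis
  proof (rule that)
    show "Vector_Spaces.linear (scl G) (scl H) l"
    proof (unfold_locales)
      fix x y c
      have "i (l (x + y)) = i (l x + l y)"
        by (simp add: i.add i_l s.add \<gamma>.add \<alpha>.add)
      then show "l (x + y) = l x + l y" using i_inj by (simp add: inj_eq)
      have "i (l (scl G c x)) = i (scl H c (l x))"
        by (simp add: i.scale i_l s.scale \<gamma>.scale \<alpha>.scale E.scale_right_diff_distrib)
      then show "l (scl G c x) = scl H c (l x)" using i_inj by (simp add: inj_eq)
    qed
    show "triangular_lift H i E p G s \<beta> \<alpha> l \<gamma>"
    proof (unfold_locales)
      show "\<gamma> (i h) = i (\<beta> h)" for h using \<gamma>(2) by (simp add: fun_eq_iff)
      show "\<gamma> (s x) = s (\<alpha> x) + i (l x)" for x by (simp add: i_l)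
    qed (use assms in auto)
  qed
qed

text \<open>
  The block \<open>l\<close> may be prescribed freely. In the formula for \<open>\<gamma>\<close> below, \<open>P e\<close> is the
  \<open>\<hh>\<close>-component of \<open>e\<close> for the splitting by \<open>s\<close>.
\<close>

lemma lift_exists:
  assumes s: "is_section E p G s" and \<beta>: "\<beta> \<in> rb_Aut H" and \<alpha>: "\<alpha> \<in> rb_Aut G"
    and l: "Vector_Spaces.linear (scl G) (scl H) l"
  obtains \<gamma> where "triangular_lift H i E p G s \<beta> \<alpha> l \<gamma>"
proof -
  define P where "P e = inv i (e - s (p e))" for e
  define \<gamma> where "\<gamma> e = i (\<beta> (P e)) + (s (\<alpha> (p e)) + i (l (p e)))" for e
  interpret s: Vector_Spaces.linear "scl G" "scl E" s using s by (simp add: is_section_def)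
  interpret l: Vector_Spaces.linear "scl G" "scl H" l by (rule l)
  interpret \<beta>: Vector_Spaces.linear "scl H" "scl H" \<beta>
    using \<beta> by (simp add: rb_Aut_def rb_morphism_def)
  interpret \<alpha>: Vector_Spaces.linear "scl G" "scl G" \<alpha>
    using \<alpha> by (simp add: rb_Aut_def rb_morphism_def)
  have p_s: "p (s x) = x" for x
    using s by (simp add: is_section_def pointfree_idE)
  have i_P: "i (P e) = e - s (p e)" for e
    by (simp add: P_def i_inv p_diff p_s)
  have P_eqI: "P e = h" if "i h = e - s (p e)" for e h
    using i_inj by (simp only: P_def that[symmetric] inv_f_f)
  have P_add: "P (a + b) = P a + P b" for a b
    by (rule P_eqI) (simp add: i.add i_P p.add s.add)
  have P_scale: "P (scl E c a) = scl H c (P a)" for c a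
    by (rule P_eqI) (simp add: i.scale i_P p.scale s.scale E.scale_right_diff_distrib)
  have "P (i h) = h" "P (s x) = 0" for h x
    by (rule P_eqI; simp add: p_i p_s s.zero i.zero)+
  then have \<gamma>_i: "\<gamma> (i h) = i (\<beta> h)" and \<gamma>_s: "\<gamma> (s x) = s (\<alpha> x) + i (l x)" for h x
    by (simp_all add: \<gamma>_def p_i p_s s.zero i.zero \<alpha>.zero \<beta>.zero l.zero)
  have "triangular_lift H i E p G s \<beta> \<alpha> l \<gamma>"
  proof (unfold_locales)
    show "\<gamma> (a + b) = \<gamma> a + \<gamma> b" for a b
      by (simp add: \<gamma>_def P_add p.add s.add i.add \<alpha>.add \<beta>.add l.add)
    show "\<gamma> (scl E c a) = scl E c (\<gamma> a)" for c a
      by (simp add: \<gamma>_def P_scale p.scale s.scale i.scale \<alpha>.scale \<beta>.scale l.scale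
          E.scale_right_distrib)
  qed (use s \<beta> \<alpha> \<gamma>_i \<gamma>_s in auto)
  then show thesis by (rule that)
qed

end

section \<open>Inducible pairs\<close>

theorem theorem4p1:
  fixes H :: "('k::field_char_0, 'h::ab_group_add) rb_lie"
    and E :: "('k, 'e::ab_group_add) rb_lie"
    and G :: "('k, 'g::ab_group_add) rb_lie"
    and i :: "'h \<Rightarrow> 'e" and p :: "'e \<Rightarrow> 'g" and s :: "'g \<Rightarrow> 'e"
    and \<chi> :: "'g \<Rightarrow> 'g \<Rightarrow> 'h" and \<psi> :: "'g \<Rightarrow> 'h \<Rightarrow> 'h" and \<Phi> :: "'g \<Rightarrow> 'h"
    and \<beta> :: "'h \<Rightarrow> 'h" and \<alpha> :: "'g \<Rightarrow> 'g"
  assumes "rb_extension H i E p G"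
    and "is_section E p G s"
    and "(\<chi>, \<psi>, \<Phi>) = induced_cocycle i E G s"
    and "(\<beta>, \<alpha>) \<in> rb_Aut H \<times> rb_Aut G"
  shows "inducible i E p s \<beta> \<alpha> \<longleftrightarrow>
    (\<exists>l. Vector_Spaces.linear (scl G) (scl H) l \<and>
      (\<forall>x h. \<beta> (\<psi> x h) - \<psi> (\<alpha> x) (\<beta> h) = brk H (l x) (\<beta> h)) \<and>
      (\<forall>x y. \<beta> (\<chi> x y) - \<chi> (\<alpha> x) (\<alpha> y) =
        \<psi> (\<alpha> x) (l y) - \<psi> (\<alpha> y) (l x) - l (brk G x y) + brk H (l x) (l y)) \<and>
      (\<forall>x. \<beta> (\<Phi> x) - \<Phi> (\<alpha> x) = rbop H (l x) - l (rbop G x)))"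
    (is "_ \<longleftrightarrow> (\<exists>l. ?lin l \<and> ?conditions l)")
proof -
  interpret rb_extension H i E p G by (rule assms(1))
  have \<beta>: "\<beta> \<in> rb_Aut H" and \<alpha>: "\<alpha> \<in> rb_Aut G" using assms(4) by auto
  have cocycle: "\<chi> = cocycle_chi i E G s" "\<psi> = cocycle_psi i E s" "\<Phi> = cocycle_Phi i E G s"
    using assms(3) by (auto simp: induced_cocycle_def)
  have morphism_iff: "rb_morphism E E \<gamma> \<longleftrightarrow> ?conditions l"
    if "triangular_lift H i E p G s \<beta> \<alpha> l \<gamma>" for l \<gamma>
    unfolding cocycle by (rule triangular_lift.lift_morphism_iff[OF that])
  show ?thesis
  proof
    assume "inducible i E p s \<beta> \<alpha>"
    then obtain \<gamma> where \<gamma>: "\<gamma> \<in> rb_Aut E" "\<gamma> \<circ> i = i \<circ> \<beta>" "p \<circ> \<gamma> \<circ> s = \<alpha>"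
      by (auto simp: inducible_def)
    obtain l where "?lin l" and lift: "triangular_lift H i E p G s \<beta> \<alpha> l \<gamma>"
      using lift_of_automorphism[OF assms(2) \<beta> \<alpha> \<gamma>] .
    moreover have "?conditions l"
      using \<gamma>(1) morphism_iff[OF lift] by (simp add: rb_Aut_def)
    ultimately show "\<exists>l. ?lin l \<and> ?conditions l" by blast
  next
    assume "\<exists>l. ?lin l \<and> ?conditions l"
    then obtain l where "?lin l" and conditions: "?conditions l" by blast
    then obtain \<gamma> where lift: "triangular_lift H i E p G s \<beta> \<alpha> l \<gamma>"
      using lift_exists[OF assms(2) \<beta> \<alpha>] by blast
    interpret triangular_lift H i E p G s \<beta> \<alpha> l \<gamma> by (rule lift)
    have "\<gamma> \<in> rb_Aut E"
      using conditions morphism_iff[OF lift] bij_lift by (simp add: rb_Aut_def)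
    moreover have "\<gamma> \<circ> i = i \<circ> \<beta>" by (rule ext) (simp add: \<gamma>_i)
    ultimately show "inducible i E p s \<beta> \<alpha>"
      unfolding inducible_def using lift_image_kernel lift_induces_quotient_map by blast
  qed
qed

end
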